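(* Let $A\in\mathbb{R}^{n\times n}$, $B\in\mathbb{R}^{n\times m}$ with $(A,B)$ controllable, let $\alpha>0$ and let $P\in\mathbb{R}^{n\times n}$ be symmetric positive definite with $PA+A^TP-2PBB^TP+2\alpha P<0$. Let $\mathcal{G}$ be an undirected connected graph on $N$ nodes with Laplacian $\mathcal{L}$ whose second smallest eigenvalue is $\lambda_2>0$. Set $F=-B^TP$, choose $c\geq 1/\lambda_2$, and define $\hat{\mathcal{L}}=\mathcal{L}\otimes P$, $\bar A=I_N\otimes A$, $\bar B=c\,\mathcal{L}\otimes BF$, $A_c=\bar A+\bar B$. Then the symmetric matrix $\bar{\mathcal{L}}=\hat{\mathcal{L}}A_c+A_c^T\hat{\mathcal{L}}$ has exactly $n$ eigenvalues equal to zero and all its other eigenvalues are negative. Moreover, the eigenvectors of $\bar{\mathcal{L}}$ associated with its zero eigenvalues belong to the subspace spanned by the eigenvectors of $\hat{\mathcal{L}}$ associated with its $n$ zero eigenvalues (i.e. vectors of the form $\mathbf{1}_N\otimes\varsigma$, $\varsigma\in\mathbb{R}^n$).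
   Context: $\mathcal{L}=\mathcal{D}-\mathcal{A}$ is the Laplacian of the graph ($\mathcal{A}$ the 0/1 adjacency matrix, $\mathcal{D}$ the diagonal degree matrix); for a connected undirected graph its eigenvalues are $0=\lambda_1<\lambda_2\le\dots\le\lambda_N$. $\otimes$ is the Kronecker product, $I_N$ the $N\times N$ identity, $\mathbf{1}_N$ the all-ones vector. *)

theory Defs
  imports "Jordan_Normal_Form.Char_Poly" "Jordan_Normal_Form.DL_Rank"
    "HOL-Library.Multiset"
begin

text \<open>Kronecker product of matrices: (p x q) (x) (r x s) is (p r) x (q s).\<close>
definition kron :: "real mat \<Rightarrow> real mat \<Rightarrow> real mat" where
  "kron X Y = mat (dim_row X * dim_row Y) (dim_col X * dim_col Y)
     (\<lambda>(i,j). X $$ (i div dim_row Y, j div dim_col Y) * Y $$ (i mod dim_row Y, j mod dim_col Y))"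

text \<open>The vector 1_N (x) s in R^(N n).\<close>
definition ones_kron :: "nat \<Rightarrow> real vec \<Rightarrow> real vec" where
  "ones_kron N s = vec (N * dim_vec s) (\<lambda>i. s $ (i mod dim_vec s))"

definition sym_mat :: "real mat \<Rightarrow> bool" where
  "sym_mat M \<longleftrightarrow> transpose_mat M = M"

definition pos_def :: "nat \<Rightarrow> real mat \<Rightarrow> bool" where
  "pos_def n M \<longleftrightarrow> M \<in> carrier_mat n n \<and> sym_mat M \<and>
     (\<forall>x \<in> carrier_vec n. x \<noteq> 0\<^sub>v n \<longrightarrow> x \<bullet> (M *\<^sub>v x) > 0)"

text \<open>M < 0: symmetric negative definite.\<close>
definition neg_def :: "nat \<Rightarrow> real mat \<Rightarrow> bool" where
  "neg_def n M \<longleftrightarrow> M \<in> carrier_mat n n \<and> sym_mat M \<and>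
     (\<forall>x \<in> carrier_vec n. x \<noteq> 0\<^sub>v n \<longrightarrow> x \<bullet> (M *\<^sub>v x) < 0)"

text \<open>Kalman controllability matrix [B, AB, ..., A^(n-1) B] (n x n m).\<close>
definition ctrb_mat :: "nat \<Rightarrow> nat \<Rightarrow> real mat \<Rightarrow> real mat \<Rightarrow> real mat" where
  "ctrb_mat n m A B = mat n (n * m) (\<lambda>(i,j). (A ^\<^sub>m (j div m) * B) $$ (i, j mod m))"

definition controllable :: "nat \<Rightarrow> nat \<Rightarrow> real mat \<Rightarrow> real mat \<Rightarrow> bool" where
  "controllable n m A B \<longleftrightarrow> A \<in> carrier_mat n n \<and> B \<in> carrier_mat n m \<and>
     vec_space.rank n (ctrb_mat n m A B) = n"

text \<open>Undirected simple graph on nodes 0..N-1 given by its 0/1 adjacency matrix.\<close>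
definition adj_graph :: "nat \<Rightarrow> real mat \<Rightarrow> bool" where
  "adj_graph N Adj \<longleftrightarrow> Adj \<in> carrier_mat N N \<and>
     (\<forall>i<N. \<forall>j<N. (Adj $$ (i,j) = 0 \<or> Adj $$ (i,j) = 1) \<and> Adj $$ (i,j) = Adj $$ (j,i)) \<and>
     (\<forall>i<N. Adj $$ (i,i) = 0)"

definition connected_adj :: "nat \<Rightarrow> real mat \<Rightarrow> bool" where
  "connected_adj N Adj \<longleftrightarrow>
     (\<forall>i<N. \<forall>j<N. (i, j) \<in> {(a,b). a < N \<and> b < N \<and> Adj $$ (a,b) = 1}\<^sup>*)"

definition laplacian :: "nat \<Rightarrow> real mat \<Rightarrow> real mat" where
  "laplacian N Adj = mat N N (\<lambda>(i,j). (if i = j then (\<Sum>k<N. Adj $$ (i,k)) else 0) - Adj $$ (i,j))"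

text \<open>Eigenvalues counted with algebraic multiplicity, as multiset of roots of the
  characteristic polynomial; sorted increasingly.\<close>
definition eigenvalues_sorted :: "real mat \<Rightarrow> real list" where
  "eigenvalues_sorted M = sorted_list_of_multiset (proots (char_poly M))"

end

theory Submission
  imports Defs
begin

text \<open>Put \<open>M = P B B\<^sup>T P\<close>, \<open>Q = P A + A\<^sup>T P - 2 M\<close> and \<open>X = c L\<^sup>2 - L\<close>. Then the matrix under
  study is \<open>L \<otimes> Q - 2 X \<otimes> M\<close>. The spectral gap of \<open>L\<close> makes \<open>X\<close>, hence also
  \<open>X \<otimes> M\<close>, positive semidefinite, while the Riccati inequality makes \<open>Q\<close> negative definite, so
  that \<open>x\<^sup>T (L \<otimes> Q) x\<close>, half the sum of \<open>(x\<^sub>i - x\<^sub>j)\<^sup>T Q (x\<^sub>i - x\<^sub>j)\<close> over adjacent \<open>i, j\<close>, is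
  nonpositive and vanishes, by connectivity, only when all blocks of \<open>x\<close> agree. The kernel is therefore
  \<open>{1 \<otimes> s}\<close>, and by symmetry its dimension \<open>n\<close> is also the algebraic multiplicity of \<open>0\<close>.\<close>

section \<open>Positive semidefinite real matrices\<close>

lemma smult_mat_mult_vec:
  assumes "A \<in> carrier_mat nr nc" "v \<in> carrier_vec nc"
  shows "(k \<cdot>\<^sub>m A) *\<^sub>v v = (k :: 'a :: comm_ring_1) \<cdot>\<^sub>v (A *\<^sub>v v)"
  using assms by (intro eq_vecI) auto

lemma transpose_smult: "transpose_mat (k \<cdot>\<^sub>m A) = k \<cdot>\<^sub>m transpose_mat A"
  by (intro eq_matI) auto

lemma scalar_prod_self_nonneg: "(x :: real vec) \<bullet> x \<ge> 0"
  unfolding scalar_prod_def by (rule sum_nonneg) auto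

lemma scalar_prod_self_eq_0:
  assumes "(x :: real vec) \<in> carrier_vec n" "x \<bullet> x \<le> 0"
  shows "x = 0\<^sub>v n"
proof -
  have "(\<Sum>i\<in>{0..<n}. x $ i * x $ i) = 0"
    using assms scalar_prod_self_nonneg[of x] unfolding scalar_prod_def by auto
  then have "\<forall>i\<in>{0..<n}. x $ i * x $ i = 0"
    by (subst (asm) sum_nonneg_eq_0_iff) auto
  then show ?thesis using assms(1) by (intro eq_vecI) auto
qed

lemma sym_mat_scalar_prod:
  assumes "sym_mat M" "M \<in> carrier_mat n n" "x \<in> carrier_vec n" "y \<in> carrier_vec n"
  shows "x \<bullet> (M *\<^sub>v y) = (M *\<^sub>v x) \<bullet> y"
  using transpose_vec_mult_scalar[OF assms(2,4,3)] assms(1) by (simp add: sym_mat_def)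

text \<open>Each product |x_i x_j| is at most |x|^2, because 2|x_i x_j| <= x_i^2 + x_j^2, so the sum
  of the absolute entries of \<open>M\<close> serves as the constant. The added 1 keeps it positive
  even for a zero matrix.\<close>

lemma quad_form_bound:
  fixes M :: "real mat"
  assumes M: "M \<in> carrier_mat n n"
  shows "\<exists>K>0. \<forall>x\<in>carrier_vec n. \<bar>x \<bullet> (M *\<^sub>v x)\<bar> \<le> K * (x \<bullet> x)"
proof (intro exI conjI ballI)
  let ?K = "(\<Sum>i<n. \<Sum>j<n. \<bar>M $$ (i,j)\<bar>) + 1"
  show "?K > 0" by (smt (verit) sum_nonneg abs_ge_zero)
  fix x :: "real vec" assume x: "x \<in> carrier_vec n"
  have sq: "x $ i * x $ i \<le> x \<bullet> x" if "i < n" for i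
    unfolding scalar_prod_def using x that
    by (intro member_le_sum[of i _ "\<lambda>i. x $ i * x $ i"]) auto
  have ab: "\<bar>x $ i\<bar> * \<bar>x $ j\<bar> \<le> x \<bullet> x" if "i < n" "j < n" for i j
  proof -
    have "0 \<le> (\<bar>x $ i\<bar> - \<bar>x $ j\<bar>)\<^sup>2" by simp
    then have "2 * (\<bar>x $ i\<bar> * \<bar>x $ j\<bar>) \<le> x $ i * x $ i + x $ j * x $ j"
      by (simp add: power2_eq_square algebra_simps)
    then show ?thesis using sq[OF that(1)] sq[OF that(2)] by linarith
  qed
  have "x \<bullet> (M *\<^sub>v x) = (\<Sum>i<n. \<Sum>j<n. x $ i * (M $$ (i,j) * x $ j))"
    using x M by (auto simp: scalar_prod_def sum_distrib_left atLeast0LessThan intro!: sum.cong)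
  also have "\<bar>\<dots>\<bar> \<le> (\<Sum>i<n. \<bar>\<Sum>j<n. x $ i * (M $$ (i,j) * x $ j)\<bar>)"
    by (rule sum_abs)
  also have "\<dots> \<le> (\<Sum>i<n. \<Sum>j<n. \<bar>x $ i * (M $$ (i,j) * x $ j)\<bar>)"
    by (intro sum_mono sum_abs)
  also have "\<dots> \<le> (\<Sum>i<n. \<Sum>j<n. \<bar>M $$ (i,j)\<bar> * (x \<bullet> x))"
  proof (intro sum_mono)
    fix i j assume "i \<in> {..<n}" "j \<in> {..<n}"
    then have "\<bar>M $$ (i,j)\<bar> * (\<bar>x $ i\<bar> * \<bar>x $ j\<bar>) \<le> \<bar>M $$ (i,j)\<bar> * (x \<bullet> x)"
      by (intro mult_left_mono ab) auto
    then show "\<bar>x $ i * (M $$ (i,j) * x $ j)\<bar> \<le> \<bar>M $$ (i,j)\<bar> * (x \<bullet> x)"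
      by (simp add: abs_mult algebra_simps)
  qed
  also have "\<dots> \<le> ?K * (x \<bullet> x)"
    using scalar_prod_self_nonneg[of x] by (simp add: sum_distrib_right distrib_right)
  finally show "\<bar>x \<bullet> (M *\<^sub>v x)\<bar> \<le> ?K * (x \<bullet> x)" .
qed

text \<open>The discriminant argument for t -> (x + t y)^T M (x + t y), a nonnegative quadratic
  polynomial. Its leading coefficient \<open>?d\<close> may vanish for nonzero \<open>y\<close>,
  hence the case split.\<close>

lemma psd_Cauchy_Schwarz:
  fixes M :: "real mat"
  assumes M: "M \<in> carrier_mat n n" and sym: "sym_mat M"
    and psd: "\<And>x. x \<in> carrier_vec n \<Longrightarrow> x \<bullet> (M *\<^sub>v x) \<ge> 0"
    and x: "x \<in> carrier_vec n" and y: "y \<in> carrier_vec n"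
  shows "(x \<bullet> (M *\<^sub>v y))\<^sup>2 \<le> (x \<bullet> (M *\<^sub>v x)) * (y \<bullet> (M *\<^sub>v y))"
proof -
  let ?a = "x \<bullet> (M *\<^sub>v x)" and ?b = "x \<bullet> (M *\<^sub>v y)" and ?d = "y \<bullet> (M *\<^sub>v y)"
  have Mx: "M *\<^sub>v x \<in> carrier_vec n" and My: "M *\<^sub>v y \<in> carrier_vec n" using M x y by auto
  have yx: "y \<bullet> (M *\<^sub>v x) = ?b"
    using sym_mat_scalar_prod[OF sym M y x] comm_scalar_prod[OF x My] by simp
  have q: "0 \<le> ?a + 2 * t * ?b + t\<^sup>2 * ?d" for t
  proof -
    have ty: "t \<cdot>\<^sub>v y \<in> carrier_vec n" using y by simp
    have "0 \<le> (x + t \<cdot>\<^sub>v y) \<bullet> (M *\<^sub>v (x + t \<cdot>\<^sub>v y))" using x y by (intro psd) auto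
    also have "M *\<^sub>v (x + t \<cdot>\<^sub>v y) = M *\<^sub>v x + t \<cdot>\<^sub>v (M *\<^sub>v y)"
      using mult_add_distrib_mat_vec[OF M x ty] mult_mat_vec[OF M y] by simp
    also have "(x + t \<cdot>\<^sub>v y) \<bullet> (M *\<^sub>v x + t \<cdot>\<^sub>v (M *\<^sub>v y)) = ?a + 2 * t * ?b + t\<^sup>2 * ?d"
      using x y Mx My yx
      by (simp add: add_scalar_prod_distrib[of _ n] scalar_prod_add_distrib[of _ n]
          power2_eq_square algebra_simps)
    finally show ?thesis .
  qed
  show ?thesis
  proof (cases "?d = 0")
    case True
    have "?b = 0"
    proof (rule ccontr)
      assume "?b \<noteq> 0"
      \<comment> \<open>With \<open>?d = 0\<close> the polynomial is affine in t, and this choice of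
        t gives it the value -1.\<close>
      then show False using q[of "- (?a + 1) / (2 * ?b)"] True by (simp add: field_simps)
    qed
    then show ?thesis using True by simp
  next
    case False
    then have d: "?d > 0" using psd[OF y] by simp
    \<comment> \<open>The point \<open>- ?b / ?d\<close> minimizes the polynomial; its minimum times
      \<open>?d\<close> is the discriminant expression.\<close>
    have "0 \<le> ?d * (?a + 2 * (- ?b / ?d) * ?b + (- ?b / ?d)\<^sup>2 * ?d)"
      using q[of "- ?b / ?d"] d by simp
    also have "\<dots> = ?a * ?d - ?b\<^sup>2"
      using d by (simp add: power2_eq_square field_simps)
    finally show ?thesis by simp
  qed
qed

section \<open>Coercivity, and the sign of a form from its eigenvalues\<close>

lemma trivial_kernel_imp_right_inverse:
  fixes M :: "'a :: field mat"
  assumes M: "M \<in> carrier_mat n n"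
    and ker: "\<And>x. x \<in> carrier_vec n \<Longrightarrow> M *\<^sub>v x = 0\<^sub>v n \<Longrightarrow> x = 0\<^sub>v n"
  obtains W where "W \<in> carrier_mat n n" "M * W = 1\<^sub>m n"
proof -
  have "det M \<noteq> 0" using ker det_0_iff_vec_prod_zero_field[OF M] by auto
  from det_non_zero_imp_unit[OF M this, unfolded Units_def, of "()"] that
  show thesis by (auto simp: ring_mat_def)
qed

text \<open>Cauchy-Schwarz for the form of \<open>M\<close>, applied to \<open>x\<close> and the
  solution z = W x of M z = x, gives |x|^4 <= (x^T M x) (z^T x). The last factor is at most K |x|^2,
  and one |x|^2 cancels.\<close>

lemma psd_trivial_kernel_coercive:
  fixes M :: "real mat"
  assumes M: "M \<in> carrier_mat n n" and sym: "sym_mat M"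
    and psd: "\<And>x. x \<in> carrier_vec n \<Longrightarrow> x \<bullet> (M *\<^sub>v x) \<ge> 0"
    and ker: "\<And>x. x \<in> carrier_vec n \<Longrightarrow> M *\<^sub>v x = 0\<^sub>v n \<Longrightarrow> x = 0\<^sub>v n"
  shows "\<exists>K>0. \<forall>x\<in>carrier_vec n. x \<bullet> x \<le> K * (x \<bullet> (M *\<^sub>v x))"
proof -
  obtain W where W: "W \<in> carrier_mat n n" "M * W = 1\<^sub>m n"
    using trivial_kernel_imp_right_inverse[OF M ker] by blast
  obtain K where K: "K > 0" "\<And>x. x \<in> carrier_vec n \<Longrightarrow> \<bar>x \<bullet> (W *\<^sub>v x)\<bar> \<le> K * (x \<bullet> x)"
    using quad_form_bound[OF W(1)] by blast
  show ?thesis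
  proof (intro exI conjI ballI)
    fix x :: "real vec" assume x: "x \<in> carrier_vec n"
    let ?z = "W *\<^sub>v x"
    have z: "?z \<in> carrier_vec n" using W x by simp
    have Mz: "M *\<^sub>v ?z = x"
      using assoc_mult_mat_vec[OF M W(1) x, symmetric] W(2) x by simp
    have "(x \<bullet> x)\<^sup>2 \<le> (x \<bullet> (M *\<^sub>v x)) * (?z \<bullet> x)"
      using psd_Cauchy_Schwarz[OF M sym psd x z] Mz by simp
    also have "\<dots> \<le> (x \<bullet> (M *\<^sub>v x)) * (K * (x \<bullet> x))"
      using K(2)[OF x] comm_scalar_prod[OF x z] psd[OF x] by (intro mult_left_mono) auto
    finally have "(x \<bullet> x) * (x \<bullet> x) \<le> (x \<bullet> x) * (K * (x \<bullet> (M *\<^sub>v x)))"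
      by (simp add: power2_eq_square algebra_simps)
    then show "x \<bullet> x \<le> K * (x \<bullet> (M *\<^sub>v x))"
      using scalar_prod_self_nonneg[of x] psd[OF x] K(1)
      by (cases "x \<bullet> x = 0") (auto simp: mult_le_cancel_left)
  qed (fact K(1))
qed

text \<open>The infimum \<open>m\<close> of all \<open>t \<ge> 0\<close> for which \<open>M + t I\<close> is positive semidefinite is
  attained. If it were positive, then \<open>M + m I\<close> would be invertible, hence coercive, and \<open>m\<close>
  could be lowered. This replaces compactness of the unit sphere.\<close>

lemma psd_if_no_neg_eigenvalue:
  fixes M :: "real mat"
  assumes M: "M \<in> carrier_mat n n" and sym: "sym_mat M"
    and ev: "\<And>\<mu>. eigenvalue M \<mu> \<Longrightarrow> \<mu> \<ge> 0"
    and x: "x \<in> carrier_vec n"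
  shows "x \<bullet> (M *\<^sub>v x) \<ge> 0"
proof -
  define T where "T = {t. t \<ge> 0 \<and> (\<forall>x\<in>carrier_vec n. x \<bullet> (M *\<^sub>v x) + t * (x \<bullet> x) \<ge> 0)}"
  define m where "m = Inf T"
  obtain K where K: "K > 0" "\<And>x. x \<in> carrier_vec n \<Longrightarrow> \<bar>x \<bullet> (M *\<^sub>v x)\<bar> \<le> K * (x \<bullet> x)"
    using quad_form_bound[OF M] by blast
  have "K \<in> T" using K unfolding T_def by (auto intro: less_imp_le) (smt (verit))
  then have ne: "T \<noteq> {}" by auto
  have bdd: "bdd_below T" unfolding T_def by (rule bdd_belowI[of _ 0]) auto
  have m0: "m \<ge> 0" unfolding m_def by (rule cInf_greatest[OF ne]) (auto simp: T_def)
  have mT: "y \<bullet> (M *\<^sub>v y) + m * (y \<bullet> y) \<ge> 0" if y: "y \<in> carrier_vec n" for y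
  proof (cases "y \<bullet> y = 0")
    case True
    then have "y = 0\<^sub>v n" using scalar_prod_self_eq_0[OF y] by simp
    then show ?thesis using M by simp
  next
    case False
    then have pos: "y \<bullet> y > 0" using scalar_prod_self_nonneg[of y] by simp
    \<comment> \<open>Every t in \<open>T\<close> dominates the Rayleigh quotient of -M at
      \<open>y\<close>, so the infimum does as well; hence it is attained.\<close>
    have "- (y \<bullet> (M *\<^sub>v y)) / (y \<bullet> y) \<le> m" unfolding m_def
    proof (rule cInf_greatest[OF ne])
      fix t assume "t \<in> T"
      then have "y \<bullet> (M *\<^sub>v y) + t * (y \<bullet> y) \<ge> 0" using y by (auto simp: T_def)
      then show "- (y \<bullet> (M *\<^sub>v y)) / (y \<bullet> y) \<le> t" using pos by (simp add: field_simps)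
    qed
    then show ?thesis using pos by (simp add: field_simps)
  qed
  have "m = 0"
  proof (rule ccontr)
    assume "m \<noteq> 0"
    then have mpos: "m > 0" using m0 by simp
    let ?N = "M + m \<cdot>\<^sub>m 1\<^sub>m n"
    have N: "?N \<in> carrier_mat n n" using M by simp
    have Nv: "?N *\<^sub>v y = M *\<^sub>v y + m \<cdot>\<^sub>v y" if "y \<in> carrier_vec n" for y
      using add_mult_distrib_mat_vec[OF M _ that, of "m \<cdot>\<^sub>m 1\<^sub>m n"]
        smult_mat_mult_vec[OF one_carrier_mat that, of m] that by simp
    have q: "y \<bullet> (?N *\<^sub>v y) = y \<bullet> (M *\<^sub>v y) + m * (y \<bullet> y)" if "y \<in> carrier_vec n" for y
      using M that by (simp add: Nv scalar_prod_add_distrib[of _ n])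
    have symN: "sym_mat ?N"
      using sym M by (simp add: sym_mat_def transpose_add[of _ n n] transpose_smult)
    have "y = 0\<^sub>v n" if y: "y \<in> carrier_vec n" and "?N *\<^sub>v y = 0\<^sub>v n" for y
    proof (rule ccontr)
      assume "y \<noteq> 0\<^sub>v n"
      moreover have "M *\<^sub>v y = (- m) \<cdot>\<^sub>v y"
      proof (rule eq_vecI)
        fix i assume i: "i < dim_vec ((- m) \<cdot>\<^sub>v y)"
        have "(M *\<^sub>v y + m \<cdot>\<^sub>v y) $ i = 0" using that i Nv[OF y] by simp
        then show "(M *\<^sub>v y) $ i = ((- m) \<cdot>\<^sub>v y) $ i" using i y M by simp
      qed (use M y in auto)
      ultimately have "eigenvalue M (- m)"
        using M y unfolding eigenvalue_def eigenvector_def by auto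
      then show False using ev mpos by force
    qed
    then obtain C where C: "C > 0" "\<And>y. y \<in> carrier_vec n \<Longrightarrow> y \<bullet> y \<le> C * (y \<bullet> (?N *\<^sub>v y))"
      using psd_trivial_kernel_coercive[OF N symN] q mT by force
    \<comment> \<open>Coercivity with constant \<open>C\<close> leaves room to lower
      \<open>m\<close> by \<open>1 / C\<close>. The maximum with 0 respects the constraint t >= 0 in
      \<open>T\<close> and still lies below \<open>m\<close>, which is positive.\<close>
    let ?t = "max 0 (m - 1 / C)"
    have "?t \<in> T" unfolding T_def
    proof (intro CollectI conjI ballI)
      fix y :: "real vec" assume y: "y \<in> carrier_vec n"
      have "(y \<bullet> y) / C \<le> y \<bullet> (M *\<^sub>v y) + m * (y \<bullet> y)"
        using C(2)[OF y] C(1) q[OF y] by (simp add: field_simps)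
      then have "0 \<le> y \<bullet> (M *\<^sub>v y) + (m - 1 / C) * (y \<bullet> y)" by (simp add: algebra_simps)
      also have "\<dots> \<le> y \<bullet> (M *\<^sub>v y) + ?t * (y \<bullet> y)"
        using scalar_prod_self_nonneg[of y] by (intro add_left_mono mult_right_mono) auto
      finally show "0 \<le> y \<bullet> (M *\<^sub>v y) + ?t * (y \<bullet> y)" .
    qed simp
    then have "m \<le> ?t" unfolding m_def by (rule cInf_lower[OF _ bdd])
    then show False using mpos C(1) by (simp add: max_def split: if_splits)
  qed
  then show ?thesis using mT[OF x] by simp
qed

section \<open>Spectral gap\<close>

text \<open>An eigenvector \<open>v\<close> for \<open>\<mu> < 0\<close> of \<open>L\<^sup>2 - r L\<close> satisfies \<open>(L - r/2)\<^sup>2 v = d v\<close> with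
  \<open>d < (r/2)\<^sup>2\<close>. By symmetry \<open>d \<ge> 0\<close>, and then \<open>L\<close> has one of the eigenvalues
  \<open>r/2 \<plusminus> sqrt d\<close>, both of which lie strictly between \<open>0\<close> and \<open>r\<close>.\<close>

lemma spectral_gap_quadratic:
  fixes L :: "real mat"
  assumes L: "L \<in> carrier_mat n n" and sym: "sym_mat L" and r: "r > 0"
    and gap: "\<And>\<mu>. eigenvalue L \<mu> \<Longrightarrow> \<mu> \<le> 0 \<or> \<mu> \<ge> r"
    and x: "x \<in> carrier_vec n"
  shows "r * (x \<bullet> (L *\<^sub>v x)) \<le> x \<bullet> ((L * L) *\<^sub>v x)"
proof -
  let ?M = "L * L + (- r) \<cdot>\<^sub>m L"
  have M: "?M \<in> carrier_mat n n" using L by simp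
  have Mv: "?M *\<^sub>v y = L *\<^sub>v (L *\<^sub>v y) + (- r) \<cdot>\<^sub>v (L *\<^sub>v y)" if "y \<in> carrier_vec n" for y
    using L that add_mult_distrib_mat_vec[of "L * L" n n "(- r) \<cdot>\<^sub>m L" y]
      smult_mat_mult_vec[OF L that, of "- r"] by simp
  have symM: "sym_mat ?M"
    using sym L by (simp add: sym_mat_def transpose_add[of _ n n] transpose_smult transpose_mult[of _ n n])
  have "0 \<le> x \<bullet> (?M *\<^sub>v x)"
  proof (rule psd_if_no_neg_eigenvalue[OF M symM _ x])
    fix \<mu> assume "eigenvalue ?M \<mu>"
    then obtain v where v: "v \<in> carrier_vec n" and v0: "v \<noteq> 0\<^sub>v n" and Mvv: "?M *\<^sub>v v = \<mu> \<cdot>\<^sub>v v"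
      using L unfolding eigenvalue_def eigenvector_def by auto
    show "\<mu> \<ge> 0"
    proof (rule ccontr)
      assume "\<not> \<mu> \<ge> 0"
      then have neg: "\<mu> < 0" by simp
      have Lv: "L *\<^sub>v v \<in> carrier_vec n" and LLv: "L *\<^sub>v (L *\<^sub>v v) \<in> carrier_vec n" using L v by auto
      have LLv_eq: "(L *\<^sub>v (L *\<^sub>v v)) $ i = r * (L *\<^sub>v v) $ i + \<mu> * v $ i" if "i < n" for i
        using arg_cong[OF Mvv, of "\<lambda>w. w $ i"] Mv[OF v] that L v Lv LLv
        by (simp del: index_mult_mat_vec)
      define a where "a = r / 2"
      define d where "d = a\<^sup>2 + \<mu>"
      have shift_carrier: "L *\<^sub>v v + t \<cdot>\<^sub>v v \<in> carrier_vec n" for t using L v by simp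
      have L_shift: "L *\<^sub>v (L *\<^sub>v v + t \<cdot>\<^sub>v v) = L *\<^sub>v (L *\<^sub>v v) + t \<cdot>\<^sub>v (L *\<^sub>v v)" for t
        using mult_add_distrib_mat_vec[OF L Lv, of "t \<cdot>\<^sub>v v"] mult_mat_vec[OF L v] v by simp
      have no_ev: False if s: "w \<in> carrier_vec n" "w \<noteq> 0\<^sub>v n" "L *\<^sub>v w = s \<cdot>\<^sub>v w" "0 < s" "s < r" for w s
      proof -
        have "eigenvalue L s" using s L unfolding eigenvalue_def eigenvector_def by auto
        then show False using gap s by force
      qed
      have "d \<ge> 0"
      proof (rule ccontr)
        assume "\<not> d \<ge> 0"
        let ?u = "L *\<^sub>v v + (- a) \<cdot>\<^sub>v v"
        \<comment> \<open>Symmetry moves one factor L - a across the product, so |(L - a) v|^2 = v^T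
          (L - a)^2 v = d |v|^2.\<close>
        have "?u \<bullet> ?u = v \<bullet> (L *\<^sub>v ?u) - a * (v \<bullet> ?u)"
          using sym_mat_scalar_prod[OF sym L v shift_carrier, of "- a"] v Lv
          by (simp add: add_scalar_prod_distrib[OF Lv _ shift_carrier])
        also have "v \<bullet> (L *\<^sub>v ?u) - a * (v \<bullet> ?u) = v \<bullet> (L *\<^sub>v (L *\<^sub>v v)) - r * (v \<bullet> (L *\<^sub>v v)) + a\<^sup>2 * (v \<bullet> v)"
          using v Lv LLv unfolding L_shift
          by (simp add: scalar_prod_add_distrib[of _ n] a_def power2_eq_square algebra_simps)
        also have "v \<bullet> (L *\<^sub>v (L *\<^sub>v v)) = r * (v \<bullet> (L *\<^sub>v v)) + \<mu> * (v \<bullet> v)"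
        proof -
          have "L *\<^sub>v (L *\<^sub>v v) = r \<cdot>\<^sub>v (L *\<^sub>v v) + \<mu> \<cdot>\<^sub>v v"
            using LLv_eq L v Lv by (intro eq_vecI) (auto simp del: index_mult_mat_vec)
          then show ?thesis using v Lv by (simp add: scalar_prod_add_distrib[of _ n])
        qed
        finally have "?u \<bullet> ?u = d * (v \<bullet> v)" by (simp add: d_def algebra_simps)
        then have "d * (v \<bullet> v) \<ge> 0" using scalar_prod_self_nonneg[of ?u] by simp
        then have "v \<bullet> v \<le> 0" using \<open>\<not> d \<ge> 0\<close> by (simp add: zero_le_mult_iff)
        then show False using scalar_prod_self_eq_0[OF v] v0 by simp
      qed
      define s where "s = sqrt d"
      have s2: "s\<^sup>2 = d" and s0: "s \<ge> 0" using \<open>d \<ge> 0\<close> by (auto simp: s_def)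
      have "a > 0" using r by (simp add: a_def)
      \<comment> \<open>Negativity of \<mu> puts d = a^2 + \<mu> below a^2, so a - s and a + s both
        lie in the forbidden interval between 0 and r = 2a.\<close>
      have "s < a"
        using neg s2 power2_less_imp_less[of s a] \<open>a > 0\<close> by (simp add: d_def)
      have r_eq: "r = (a - s) + (a + s)" and \<mu>_eq: "\<mu> = - (a - s) * (a + s)"
        using s2 by (auto simp: a_def d_def power2_eq_square algebra_simps)
      \<comment> \<open>The product (L - (a + s)) (L - (a - s)) annihilates \<open>v\<close>. Either
        the inner factor already does, and a - s is an eigenvalue, or the image \<open>?u\<close> of
        \<open>v\<close> under it is an eigenvector for a + s.\<close>
      let ?u = "L *\<^sub>v v + (- (a - s)) \<cdot>\<^sub>v v"
      show False
      proof (cases "?u = 0\<^sub>v n")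
        case True
        have "L *\<^sub>v v = (a - s) \<cdot>\<^sub>v v"
        proof (rule eq_vecI)
          fix i assume "i < dim_vec ((a - s) \<cdot>\<^sub>v v)"
          then show "(L *\<^sub>v v) $ i = ((a - s) \<cdot>\<^sub>v v) $ i"
            using arg_cong[OF True, of "\<lambda>w. w $ i"] v Lv
            by (simp add: algebra_simps del: index_mult_mat_vec)
        qed (use L v in auto)
        then show False using no_ev[OF v v0, of "a - s"] \<open>s < a\<close> s0 \<open>a > 0\<close> r_eq by simp
      next
        case False
        have "L *\<^sub>v ?u = (a + s) \<cdot>\<^sub>v ?u"
        proof (rule eq_vecI)
          fix i assume "i < dim_vec ((a + s) \<cdot>\<^sub>v ?u)"
          then have i: "i < n" using v by simp
          have "(L *\<^sub>v ?u) $ i = (r - (a - s)) * (L *\<^sub>v v) $ i + \<mu> * v $ i"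
            unfolding L_shift using i v Lv LLv LLv_eq[OF i] L
            by (simp add: algebra_simps del: index_mult_mat_vec)
          also have "\<dots> = (a + s) * ((L *\<^sub>v v) $ i - (a - s) * v $ i)"
            unfolding \<mu>_eq by (subst r_eq) (simp add: algebra_simps)
          finally show "(L *\<^sub>v ?u) $ i = ((a + s) \<cdot>\<^sub>v ?u) $ i"
            using i v Lv L by (simp add: algebra_simps del: index_mult_mat_vec)
        qed (use L v in auto)
        then show False
          using no_ev[OF shift_carrier False, of "a + s"] \<open>s < a\<close> s0 \<open>a > 0\<close> r_eq by simp
      qed
    qed
  qed
  also have "x \<bullet> (?M *\<^sub>v x) = x \<bullet> ((L * L) *\<^sub>v x) - r * (x \<bullet> (L *\<^sub>v x))"
    using L x by (simp add: Mv scalar_prod_add_distrib[of _ n])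
  finally show ?thesis by simp
qed

text \<open>The least eigenvalue is 0 and stands at index 0 of the sorted list, so a nonzero
  eigenvalue can only occur from index 1 on.\<close>

lemma eigenvalues_sorted_gap:
  assumes M: "M \<in> carrier_mat n n" and ev0: "eigenvalue M 0"
    and nonneg: "\<And>\<mu>. eigenvalue M \<mu> \<Longrightarrow> \<mu> \<ge> 0"
    and ev: "eigenvalue M \<mu>"
  shows "\<mu> = 0 \<or> \<mu> \<ge> eigenvalues_sorted M ! 1"
proof (cases "\<mu> = 0")
  case False
  let ?xs = "eigenvalues_sorted M"
  have "char_poly M \<noteq> 0" using degree_monic_char_poly[OF M] by auto
  then have set: "set ?xs = {\<mu>. eigenvalue M \<mu>}"
    unfolding eigenvalues_sorted_def using eigenvalue_root_char_poly[OF M]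
    by auto
  have sorted: "sorted ?xs" unfolding eigenvalues_sorted_def by simp
  obtain i where i: "i < length ?xs" "?xs ! i = \<mu>"
    using set ev by (metis in_set_conv_nth mem_Collect_eq)
  obtain j where j: "j < length ?xs" "?xs ! j = 0"
    using set ev0 by (metis in_set_conv_nth mem_Collect_eq)
  have "i \<noteq> 0"
  proof
    assume "i = 0"
    then have "\<mu> \<le> 0" using sorted_nth_mono[OF sorted, of 0 j] i j by simp
    then show False using nonneg[OF ev] False by simp
  qed
  then show ?thesis using sorted_nth_mono[OF sorted, of 1 i] i by simp
qed simp

section \<open>Algebraic multiplicity of the eigenvalue 0\<close>

lemma char_poly_four_block_lower_left_zero:
  fixes A :: "'a :: idom mat"
  assumes A: "A \<in> carrier_mat n n" and B: "B \<in> carrier_mat n m" and D: "D \<in> carrier_mat m m"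
  shows "char_poly (four_block_mat A B (0\<^sub>m m n) D) = char_poly A * char_poly D"
proof -
  have "char_poly_matrix (four_block_mat A B (0\<^sub>m m n) D) =
      four_block_mat (char_poly_matrix A) (map_mat (\<lambda>a. [:- a:]) B) (0\<^sub>m m n) (char_poly_matrix D)"
    using A B D by (intro eq_matI) (auto simp: char_poly_matrix_def)
  then show ?thesis
    unfolding char_poly_def using A B D by (simp add: det_four_block_mat_lower_left_zero[of _ n _ m])
qed

lemma char_poly_zero_mat: "char_poly (0\<^sub>m n n :: 'a :: comm_ring_1 mat) = [:0, 1:] ^ n"
proof -
  have "char_poly_matrix (0\<^sub>m n n :: 'a mat) = [:0, 1:] \<cdot>\<^sub>m 1\<^sub>m n"
    by (intro eq_matI) (auto simp: char_poly_matrix_def)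
  then show ?thesis by (simp add: char_poly_def det_smult)
qed

lemma mat_eq_0I:
  fixes Z :: "'a :: comm_ring_1 mat"
  assumes Z: "Z \<in> carrier_mat k n" and "\<And>s. s \<in> carrier_vec n \<Longrightarrow> Z *\<^sub>v s = 0\<^sub>v k"
  shows "Z = 0\<^sub>m k n"
proof (rule eq_matI)
  fix i j assume ij: "i < dim_row (0\<^sub>m k n :: 'a mat)" "j < dim_col (0\<^sub>m k n :: 'a mat)"
  then have "(Z *\<^sub>v unit_vec n j) $ i = Z $$ (i,j)" using Z by simp
  then show "Z $$ (i,j) = 0\<^sub>m k n $$ (i,j)" using assms(2)[of "unit_vec n j"] ij by simp
qed (use Z in auto)

text \<open>Conjugating \<open>M\<close> by \<open>[[I, 0], [R, I]]\<close> makes its first \<open>n\<close> columns zero; symmetry of \<open>M\<close>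
  forces the remaining diagonal block \<open>M4 - R M2\<close> to be nonsingular.\<close>

lemma count_proots_char_poly_kernel_graph:
  fixes M R :: "real mat"
  assumes M: "M \<in> carrier_mat (n + k) (n + k)" and sym: "sym_mat M"
    and R: "R \<in> carrier_mat k n"
    and ker: "\<And>x. x \<in> carrier_vec (n + k) \<Longrightarrow>
      M *\<^sub>v x = 0\<^sub>v (n + k) \<longleftrightarrow> (\<exists>s\<in>carrier_vec n. x = s @\<^sub>v R *\<^sub>v s)"
  shows "count (proots (char_poly M)) 0 = n"
proof -
  obtain M1 M2 M3 M4 where sb: "split_block M n n = (M1, M2, M3, M4)"
    by (metis prod_cases4)
  note split = split_block[OF sb, of k k]
  have car: "M1 \<in> carrier_mat n n" "M2 \<in> carrier_mat n k" "M3 \<in> carrier_mat k n" "M4 \<in> carrier_mat k k"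
    and Meq: "M = four_block_mat M1 M2 M3 M4"
    using split M by auto
  have kerv: "M1 *\<^sub>v s + M2 *\<^sub>v (R *\<^sub>v s) = 0\<^sub>v n \<and> M3 *\<^sub>v s + M4 *\<^sub>v (R *\<^sub>v s) = 0\<^sub>v k"
    if s: "s \<in> carrier_vec n" for s
  proof -
    have "M *\<^sub>v (s @\<^sub>v R *\<^sub>v s) = 0\<^sub>v (n + k)" using ker[of "s @\<^sub>v R *\<^sub>v s"] s R by auto
    also have "0\<^sub>v (n + k) = (0\<^sub>v n @\<^sub>v 0\<^sub>v k :: real vec)" by (intro eq_vecI) auto
    finally have "(M1 *\<^sub>v s + M2 *\<^sub>v (R *\<^sub>v s)) @\<^sub>v (M3 *\<^sub>v s + M4 *\<^sub>v (R *\<^sub>v s)) = 0\<^sub>v n @\<^sub>v 0\<^sub>v k"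
      unfolding Meq using four_block_mat_mult_vec[OF car s, of "R *\<^sub>v s"] R s by simp
    then show ?thesis using append_vec_eq[of "M1 *\<^sub>v s + M2 *\<^sub>v (R *\<^sub>v s)" n "0\<^sub>v n"] car R s by simp
  qed
  \<comment> \<open>Since \<open>M\<close> kills every vector (s, R s), both of its block rows
    annihilate the block column formed by I and \<open>R\<close>.\<close>
  have top: "M1 + M2 * R = 0\<^sub>m n n"
  proof (rule mat_eq_0I)
    fix s :: "real vec" assume s: "s \<in> carrier_vec n"
    show "(M1 + M2 * R) *\<^sub>v s = 0\<^sub>v n"
      using kerv[OF s] add_mult_distrib_mat_vec[OF car(1) _ s, of "M2 * R"] car R s by simp
  qed (use car R in auto)
  have bot: "M3 + M4 * R = 0\<^sub>m k n"
  proof (rule mat_eq_0I)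
    fix s :: "real vec" assume s: "s \<in> carrier_vec n"
    show "(M3 + M4 * R) *\<^sub>v s = 0\<^sub>v k"
      using kerv[OF s] add_mult_distrib_mat_vec[OF car(3) _ s, of "M4 * R"] car R s by simp
  qed (use car R in auto)
  let ?T = "four_block_mat (1\<^sub>m n) (0\<^sub>m n k) R (1\<^sub>m k)"
  let ?Ti = "four_block_mat (1\<^sub>m n) (0\<^sub>m n k) (- R) (1\<^sub>m k)"
  let ?C = "M4 - R * M2"
  let ?B = "four_block_mat (0\<^sub>m n n) M2 (0\<^sub>m k n) ?C"
  have C: "?C \<in> carrier_mat k k" using mult_carrier_mat[OF R car(2)] by (rule minus_carrier_mat)
  have "M * ?T = four_block_mat (0\<^sub>m n n) M2 (0\<^sub>m k n) M4"
    unfolding Meq using car R top bot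
    by (subst mult_four_block_mat[of _ n n _ k _ k]) auto
  then have "?Ti * (M * ?T) = ?B"
    using car R
    by (simp, subst mult_four_block_mat[of _ n n _ k _ k]) (auto simp: minus_add_uminus_mat comm_add_mat[of _ k k] uminus_mult_left_mat)
  then have B: "?B = ?Ti * M * ?T"
    using car R M by (subst assoc_mult_mat[of _ "n+k" "n+k" _ "n+k" _ "n+k"]) auto
  have R0: "R + - R = 0\<^sub>m k n" "1\<^sub>m n + - 0\<^sub>m n n = (1\<^sub>m n :: real mat)"
    using R by (auto intro!: eq_matI)
  have "?T * ?Ti = 1\<^sub>m (n + k)"
    using R R0 by (subst mult_four_block_mat[of _ n n _ k _ k]) auto
  moreover have "?Ti * ?T = 1\<^sub>m (n + k)"
    using R by (subst mult_four_block_mat[of _ n n _ k _ k]) auto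
  ultimately have "similar_mat ?B M"
    by (intro similar_matI[OF _ _ _ B]) (use car R M in auto)
  then have cp: "char_poly M = [:0, 1:] ^ n * char_poly ?C"
    using char_poly_similar[of ?B M] char_poly_four_block_lower_left_zero[OF zero_carrier_mat car(2) C]
    unfolding char_poly_zero_mat by simp
  \<comment> \<open>If C w = 0, then M (0, w) = (u, R u) with u = M2 w, which lies in the kernel
    again. Symmetry gives |M (0, w)|^2 = (0, w)^T M (M (0, w)) = 0, so (0, w) itself is in the
    kernel. It therefore lies on the graph of \<open>R\<close> above 0, and w = 0.\<close>
  have kerC: "w = 0\<^sub>v k" if w: "w \<in> carrier_vec k" and Cw: "?C *\<^sub>v w = 0\<^sub>v k" for w
  proof -
    let ?u = "M2 *\<^sub>v w"
    have u: "?u \<in> carrier_vec n" and Ru: "R *\<^sub>v ?u \<in> carrier_vec k" and M4w: "M4 *\<^sub>v w \<in> carrier_vec k"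
      using car R w by auto
    have "?C *\<^sub>v w = M4 *\<^sub>v w - R *\<^sub>v ?u"
      using minus_mult_distrib_mat_vec[OF car(4) _ w, of "R * M2"] car R w by simp
    then have "(M4 *\<^sub>v w - R *\<^sub>v ?u) $ i = 0" if "i < k" for i
      using Cw that by (metis index_zero_vec(1))
    then have "(M4 *\<^sub>v w) $ i = (R *\<^sub>v ?u) $ i" if "i < k" for i
      using that index_minus_vec(1)[of i "R *\<^sub>v ?u" "M4 *\<^sub>v w"] carrier_vecD[OF Ru] by simp
    then have eq: "M4 *\<^sub>v w = R *\<^sub>v ?u"
      using carrier_vecD[OF M4w] carrier_vecD[OF Ru] by (intro eq_vecI) metis+
    have z: "0\<^sub>v n @\<^sub>v w \<in> carrier_vec (n + k)" and uRu: "?u @\<^sub>v R *\<^sub>v ?u \<in> carrier_vec (n + k)"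
      using w u Ru by auto
    have Mz: "M *\<^sub>v (0\<^sub>v n @\<^sub>v w) = ?u @\<^sub>v R *\<^sub>v ?u"
    proof -
      have "M1 *\<^sub>v 0\<^sub>v n = 0\<^sub>v n" "M3 *\<^sub>v 0\<^sub>v n = 0\<^sub>v k" using car by (auto intro!: eq_vecI)
      then show ?thesis
        unfolding Meq four_block_mat_mult_vec[OF car zero_carrier_vec w] eq using u Ru by simp
    qed
    have "0 = (0\<^sub>v n @\<^sub>v w) \<bullet> (M *\<^sub>v (?u @\<^sub>v R *\<^sub>v ?u))"
      using ker[OF uRu] u z by auto
    also have "\<dots> = ?u \<bullet> ?u + (R *\<^sub>v ?u) \<bullet> (R *\<^sub>v ?u)"
      using sym_mat_scalar_prod[OF sym M z uRu] scalar_prod_append[OF u Ru u Ru] Mz by simp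
    finally have "?u = 0\<^sub>v n"
      using scalar_prod_self_eq_0[OF u] scalar_prod_self_nonneg[of "R *\<^sub>v ?u"] by linarith
    then have "M *\<^sub>v (0\<^sub>v n @\<^sub>v w) = 0\<^sub>v (n + k)"
      using Mz R by (intro eq_vecI) auto
    then obtain s where s: "s \<in> carrier_vec n" "0\<^sub>v n @\<^sub>v w = s @\<^sub>v R *\<^sub>v s"
      using ker[OF z] by auto
    then have "s = 0\<^sub>v n" "w = R *\<^sub>v s"
      using append_vec_eq[of "0\<^sub>v n :: real vec" n s w "R *\<^sub>v s"] by auto
    then show "w = 0\<^sub>v k" using R by auto
  qed
  have "\<not> eigenvalue ?C 0"
  proof
    assume "eigenvalue ?C 0"
    then obtain v where v: "v \<in> carrier_vec k" "v \<noteq> 0\<^sub>v k" "?C *\<^sub>v v = 0 \<cdot>\<^sub>v v"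
      using C car R unfolding eigenvalue_def eigenvector_def by auto
    have "0 \<cdot>\<^sub>v v = 0\<^sub>v k" using v(1) by (intro eq_vecI) auto
    then show False using kerC v by simp
  qed
  \<comment> \<open>The whole multiplicity of the root 0 thus comes from the factor
    \<open>[:0, 1:] ^ n\<close>.\<close>
  then have "poly (char_poly ?C) 0 \<noteq> 0" using eigenvalue_root_char_poly[OF C] by simp
  moreover have "char_poly M \<noteq> 0" using degree_monic_char_poly[OF M] by auto
  ultimately show ?thesis
    using order_power_n_n[of "0::real" n] unfolding cp by (simp add: order_mult order_0I)
qed

section \<open>Kronecker products\<close>

lemma kron_dim [simp]:
  "dim_row (kron X Y) = dim_row X * dim_row Y" "dim_col (kron X Y) = dim_col X * dim_col Y"
  by (simp_all add: kron_def)

lemma kron_carrier [simp]: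
  "X \<in> carrier_mat p q \<Longrightarrow> Y \<in> carrier_mat r s \<Longrightarrow> kron X Y \<in> carrier_mat (p * r) (q * s)"
  by (auto intro: carrier_matI)

lemma index_kron:
  assumes "X \<in> carrier_mat p q" "Y \<in> carrier_mat r s" "i < p * r" "j < q * s"
  shows "kron X Y $$ (i,j) = X $$ (i div r, j div s) * Y $$ (i mod r, j mod s)"
  using assms by (simp add: kron_def)

lemma div_mod_bounds:
  assumes "(i::nat) < p * r"
  shows "i div r < p" "i mod r < r"
proof -
  have "r > 0" using assms by (cases r) auto
  then show "i div r < p" "i mod r < r" using assms by (auto simp: less_mult_imp_div_less)
qed

lemma block_index_bound:
  assumes "a < p" "k < (n::nat)"
  shows "a * n + k < p * n"
proof -
  have "a * n + k < Suc a * n" using assms(2) by simp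
  also have "\<dots> \<le> p * n" using assms(1) by (intro mult_le_mono1) auto
  finally show ?thesis .
qed

text \<open>Writing an index as \<open>a * n + k\<close> inverts the \<open>div\<close> and
  \<open>mod\<close> indexing in \<open>kron\<close>; sums over Kronecker indices become double sums
  over blocks and offsets.\<close>

lemma sum_blocks:
  fixes f :: "nat \<Rightarrow> 'a :: comm_monoid_add"
  shows "(\<Sum>i<p * n. f i) = (\<Sum>a<p. \<Sum>k<n. f (a * n + k))"
proof -
  have "(\<Sum>i<p * n. f i) = (\<Sum>a<p. sum f {a * n..<a * n + n})"
    by (simp add: sum.nat_group)
  also have "\<dots> = (\<Sum>a<p. \<Sum>k<n. f (a * n + k))"
  proof (rule sum.cong[OF refl])
    fix a
    show "sum f {a * n..<a * n + n} = (\<Sum>k<n. f (a * n + k))"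
      using sum.shift_bounds_nat_ivl[of f 0 "a * n" n]
      by (simp add: atLeast0LessThan add.commute)
  qed
  finally show ?thesis .
qed

text \<open>The mixed-product rule: once the inner index is split into block and offset, the sum
  factors into two independent ones.\<close>

lemma kron_mult:
  assumes X: "X \<in> carrier_mat p q" and Y: "Y \<in> carrier_mat r s"
    and Z: "Z \<in> carrier_mat q u" and W: "W \<in> carrier_mat s v"
  shows "kron X Y * kron Z W = kron (X * Z) (Y * W)"
proof (rule eq_matI)
  fix i j assume "i < dim_row (kron (X * Z) (Y * W))" "j < dim_col (kron (X * Z) (Y * W))"
  then have i: "i < p * r" and j: "j < u * v" using X Y Z W by auto
  note bi = div_mod_bounds[OF i] and bj = div_mod_bounds[OF j]
  have "(kron X Y * kron Z W) $$ (i,j) = (\<Sum>t<q * s. kron X Y $$ (i,t) * kron Z W $$ (t,j))"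
    using X Y Z W i j by (auto simp: scalar_prod_def atLeast0LessThan intro!: sum.cong)
  also have "\<dots> = (\<Sum>b<q. \<Sum>l<s. (X $$ (i div r, b) * Z $$ (b, j div v)) * (Y $$ (i mod r, l) * W $$ (l, j mod v)))"
    unfolding sum_blocks using X Y Z W i j block_index_bound
    by (intro sum.cong refl) (simp add: index_kron)
  also have "\<dots> = (\<Sum>b<q. X $$ (i div r, b) * Z $$ (b, j div v)) * (\<Sum>l<s. Y $$ (i mod r, l) * W $$ (l, j mod v))"
    by (simp add: sum_product)
  also have "\<dots> = (X * Z) $$ (i div r, j div v) * (Y * W) $$ (i mod r, j mod v)"
    using X Y Z W bi bj by (simp add: scalar_prod_def atLeast0LessThan)
  also have "\<dots> = kron (X * Z) (Y * W) $$ (i,j)"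
    using X Y Z W i j by (simp add: index_kron[of _ p u _ r v])
  finally show "(kron X Y * kron Z W) $$ (i,j) = kron (X * Z) (Y * W) $$ (i,j)" .
qed (use X Y Z W in auto)

lemma transpose_kron: "transpose_mat (kron X Y) = kron (transpose_mat X) (transpose_mat Y)"
proof (rule eq_matI)
  fix i j assume "i < dim_row (kron (transpose_mat X) (transpose_mat Y))"
    "j < dim_col (kron (transpose_mat X) (transpose_mat Y))"
  then have i: "i < dim_col X * dim_col Y" and j: "j < dim_row X * dim_row Y" by auto
  then show "transpose_mat (kron X Y) $$ (i,j) = kron (transpose_mat X) (transpose_mat Y) $$ (i,j)"
    using div_mod_bounds[OF i] div_mod_bounds[OF j] by (simp add: kron_def)
qed auto

section \<open>Stacked vectors and quadratic forms of Kronecker products\<close>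

definition block :: "nat \<Rightarrow> 'a vec \<Rightarrow> nat \<Rightarrow> 'a vec" where
  "block n x a = vec n (\<lambda>k. x $ (a * n + k))"

lemma block_carrier [simp]: "block n x a \<in> carrier_vec n"
  by (simp add: block_def)

lemma index_block [simp]: "k < n \<Longrightarrow> block n x a $ k = x $ (a * n + k)"
  by (simp add: block_def)

lemma block_eq_imp_ones_kron:
  assumes x: "x \<in> carrier_vec (N * n)" and eq: "\<And>a. a < N \<Longrightarrow> block n x a = block n x 0"
  shows "x = ones_kron N (block n x 0)"
proof (rule eq_vecI)
  fix i assume "i < dim_vec (ones_kron N (block n x 0))"
  then have i: "i < N * n" by (simp add: ones_kron_def block_def)
  note b = div_mod_bounds[OF i]
  have "x $ i = block n x (i div n) $ (i mod n)" using b by simp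
  also have "\<dots> = block n x 0 $ (i mod n)" using eq[OF b(1)] by simp
  finally show "x $ i = ones_kron N (block n x 0) $ i"
    using i b(2) by (simp add: ones_kron_def block_def)
qed (use x in \<open>auto simp: ones_kron_def block_def\<close>)

text \<open>The (a,b) block of the Kronecker product is the scalar \<open>X $$ (a,b)\<close> times
  \<open>Y\<close>; this separates the coupling between nodes from the form on a single
  node.\<close>

lemma kron_quad_form:
  assumes X: "X \<in> carrier_mat p p" and Y: "Y \<in> carrier_mat n n" and x: "x \<in> carrier_vec (p * n)"
  shows "x \<bullet> (kron X Y *\<^sub>v x) = (\<Sum>a<p. \<Sum>b<p. X $$ (a,b) * (block n x a \<bullet> (Y *\<^sub>v block n x b)))"
proof -
  have "x \<bullet> (kron X Y *\<^sub>v x) = (\<Sum>i<p * n. \<Sum>j<p * n. x $ i * (kron X Y $$ (i,j) * x $ j))"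
    using X Y x by (auto simp: scalar_prod_def sum_distrib_left atLeast0LessThan intro!: sum.cong)
  also have "\<dots> = (\<Sum>a<p. \<Sum>k<n. \<Sum>b<p. \<Sum>l<n. x $ (a * n + k) * (X $$ (a,b) * Y $$ (k,l) * x $ (b * n + l)))"
    unfolding sum_blocks using X Y block_index_bound
    by (intro sum.cong refl) (simp add: index_kron)
  also have "\<dots> = (\<Sum>a<p. \<Sum>b<p. \<Sum>k<n. \<Sum>l<n. x $ (a * n + k) * (X $$ (a,b) * Y $$ (k,l) * x $ (b * n + l)))"
    by (intro sum.cong refl sum.swap)
  also have "\<dots> = (\<Sum>a<p. \<Sum>b<p. X $$ (a,b) * (block n x a \<bullet> (Y *\<^sub>v block n x b)))"
    using Y by (intro sum.cong refl)
      (auto simp: scalar_prod_def sum_distrib_left atLeast0LessThan block_def ac_simps intro!: sum.cong)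
  finally show ?thesis .
qed

text \<open>With z_a = W^T x_a the form is the sum of X(a,b) (z_a . z_b). Grouped by coordinate k it
  becomes a sum of forms y_k^T X y_k, where y_k collects the k-th coordinates of all z_a.\<close>

lemma kron_gram_nonneg:
  assumes X: "X \<in> carrier_mat p p" and W: "W \<in> carrier_mat n m" and x: "x \<in> carrier_vec (p * n)"
    and psd: "\<And>y. y \<in> carrier_vec p \<Longrightarrow> y \<bullet> (X *\<^sub>v y) \<ge> 0"
  shows "x \<bullet> (kron X (W * transpose_mat W) *\<^sub>v x) \<ge> 0"
proof -
  define z where "z a = transpose_mat W *\<^sub>v block n x a" for a
  have z: "z a \<in> carrier_vec m" for a using W unfolding z_def by simp
  define y where "y k = vec p (\<lambda>a. z a $ k)" for k
  have "block n x a \<bullet> ((W * transpose_mat W) *\<^sub>v block n x b) = z a \<bullet> z b" for a b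
    using transpose_vec_mult_scalar[of W n m "z b" "block n x a"] W z
    by (simp add: z_def)
  then have "x \<bullet> (kron X (W * transpose_mat W) *\<^sub>v x) = (\<Sum>a<p. \<Sum>b<p. X $$ (a,b) * (z a \<bullet> z b))"
    using kron_quad_form[OF X _ x, of "W * transpose_mat W"] W by simp
  also have "\<dots> = (\<Sum>a<p. \<Sum>b<p. \<Sum>k<m. X $$ (a,b) * (z a $ k * z b $ k))"
    using z by (auto simp: scalar_prod_def sum_distrib_left atLeast0LessThan carrier_vecD intro!: sum.cong)
  also have "\<dots> = (\<Sum>a<p. \<Sum>k<m. \<Sum>b<p. X $$ (a,b) * (z a $ k * z b $ k))"
    by (intro sum.cong refl sum.swap)
  also have "\<dots> = (\<Sum>k<m. \<Sum>a<p. \<Sum>b<p. X $$ (a,b) * (z a $ k * z b $ k))"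
    by (rule sum.swap)
  also have "\<dots> = (\<Sum>k<m. y k \<bullet> (X *\<^sub>v y k))"
    using X by (auto simp: y_def scalar_prod_def sum_distrib_left atLeast0LessThan ac_simps intro!: sum.cong)
  also have "\<dots> \<ge> 0"
    by (intro sum_nonneg psd) (simp add: y_def)
  finally show ?thesis .
qed

text \<open>The product is (X 1) (x) (Y s), and zero row sums say that X 1 = 0.\<close>

lemma kron_mult_ones_kron:
  assumes X: "X \<in> carrier_mat p q" and Y: "Y \<in> carrier_mat r n" and s: "s \<in> carrier_vec n"
    and row: "\<And>a. a < p \<Longrightarrow> (\<Sum>b<q. X $$ (a,b)) = 0"
  shows "kron X Y *\<^sub>v ones_kron q s = 0\<^sub>v (p * r)"
proof (rule eq_vecI)
  fix i assume "i < dim_vec (0\<^sub>v (p * r) :: real vec)"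
  then have i: "i < p * r" by simp
  have "(kron X Y *\<^sub>v ones_kron q s) $ i = (\<Sum>j<q * n. kron X Y $$ (i,j) * ones_kron q s $ j)"
    using X Y s i by (auto simp: scalar_prod_def atLeast0LessThan ones_kron_def intro!: sum.cong)
  also have "\<dots> = (\<Sum>b<q. \<Sum>l<n. X $$ (i div r, b) * (Y $$ (i mod r, l) * s $ l))"
    unfolding sum_blocks using X Y s i block_index_bound
    by (intro sum.cong refl) (simp add: index_kron ones_kron_def)
  also have "\<dots> = (\<Sum>b<q. X $$ (i div r, b)) * (\<Sum>l<n. Y $$ (i mod r, l) * s $ l)"
    by (simp add: sum_product)
  finally show "(kron X Y *\<^sub>v ones_kron q s) $ i = 0\<^sub>v (p * r) $ i"
    using row[OF div_mod_bounds(1)[OF i]] i by simp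
qed (use X Y in simp)

section \<open>Graph Laplacians\<close>

context
  fixes N :: nat and Adj L :: "real mat"
  assumes graph: "adj_graph N Adj" and L_def: "L = laplacian N Adj"
begin

lemma laplacian_carrier: "L \<in> carrier_mat N N"
  by (simp add: L_def laplacian_def)

lemma index_laplacian:
  assumes "i < N" "j < N"
  shows "L $$ (i,j) = (if i = j then (\<Sum>k<N. Adj $$ (i,k)) else 0) - Adj $$ (i,j)"
  using assms by (simp add: L_def laplacian_def)

lemma adj_nonneg: "i < N \<Longrightarrow> j < N \<Longrightarrow> Adj $$ (i,j) \<ge> 0"
  using graph unfolding adj_graph_def by (metis order_refl zero_le_one)

lemma adj_sym: "i < N \<Longrightarrow> j < N \<Longrightarrow> Adj $$ (i,j) = Adj $$ (j,i)"
  using graph unfolding adj_graph_def by blast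

lemma laplacian_sym: "sym_mat L"
  unfolding sym_mat_def using laplacian_carrier
  by (intro eq_matI) (auto simp: index_laplacian adj_sym)

lemma laplacian_row_sum: "i < N \<Longrightarrow> (\<Sum>j<N. L $$ (i,j)) = 0"
  by (simp add: index_laplacian sum_subtractf)

text \<open>Summation by parts on the graph: the degrees contribute \<open>g a a\<close>, and
  symmetry of the adjacency matrix allows exchanging the two nodes. A general \<open>g\<close>
  serves both the scalar form of \<open>L\<close> and the form on stacked vectors; the factor 2
  reflects that each edge is counted in both directions.\<close>

lemma laplacian_sum:
  fixes g :: "nat \<Rightarrow> nat \<Rightarrow> real"
  shows "2 * (\<Sum>a<N. \<Sum>b<N. L $$ (a,b) * g a b) =
    (\<Sum>a<N. \<Sum>b<N. Adj $$ (a,b) * (g a a - g a b - g b a + g b b))"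
proof -
  let ?S = "\<Sum>a<N. \<Sum>b<N. Adj $$ (a,b) * g a b"
  let ?D = "\<Sum>a<N. \<Sum>b<N. Adj $$ (a,b) * g a a"
  have "(\<Sum>b<N. L $$ (a,b) * g a b) = (\<Sum>b<N. Adj $$ (a,b)) * g a a - (\<Sum>b<N. Adj $$ (a,b) * g a b)"
    if "a < N" for a
  proof -
    have "(\<Sum>b<N. L $$ (a,b) * g a b) =
        (\<Sum>b<N. (if a = b then (\<Sum>k<N. Adj $$ (a,k)) * g a b else 0) - Adj $$ (a,b) * g a b)"
      using that by (intro sum.cong) (auto simp: index_laplacian algebra_simps)
    also have "\<dots> = (\<Sum>b<N. Adj $$ (a,b)) * g a a - (\<Sum>b<N. Adj $$ (a,b) * g a b)"
      using that by (simp add: sum_subtractf)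
    finally show ?thesis .
  qed
  then have "(\<Sum>a<N. \<Sum>b<N. L $$ (a,b) * g a b) = ?D - ?S"
    by (simp add: sum_subtractf sum_distrib_right)
  moreover have "(\<Sum>a<N. \<Sum>b<N. Adj $$ (a,b) * g b a) = ?S"
    by (subst sum.swap) (auto simp: adj_sym intro!: sum.cong)
  moreover have "(\<Sum>a<N. \<Sum>b<N. Adj $$ (a,b) * g b b) = ?D"
    by (subst sum.swap) (auto simp: adj_sym intro!: sum.cong)
  ultimately show ?thesis
    by (simp add: sum.distrib sum_subtractf algebra_simps)
qed

text \<open>Here g(a,b) = x_a^T Q x_b in \<open>laplacian_sum\<close>; the four terms combine to the
  form of \<open>Q\<close> at x_a - x_b.\<close>

lemma kron_laplacian_quad_form:
  assumes Q: "Q \<in> carrier_mat n n" and x: "x \<in> carrier_vec (N * n)"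
  shows "2 * (x \<bullet> (kron L Q *\<^sub>v x)) = (\<Sum>a<N. \<Sum>b<N. Adj $$ (a,b) *
    ((block n x a - block n x b) \<bullet> (Q *\<^sub>v (block n x a - block n x b))))"
proof -
  have "(block n x a - block n x b) \<bullet> (Q *\<^sub>v (block n x a - block n x b)) =
    block n x a \<bullet> (Q *\<^sub>v block n x a) - block n x a \<bullet> (Q *\<^sub>v block n x b)
    - block n x b \<bullet> (Q *\<^sub>v block n x a) + block n x b \<bullet> (Q *\<^sub>v block n x b)" for a b
    using Q by (simp add: mult_minus_distrib_mat_vec[OF Q] minus_scalar_prod_distrib[of _ n]
        scalar_prod_minus_distrib[of _ n])
  then show ?thesis
    unfolding kron_quad_form[OF laplacian_carrier Q x] laplacian_sum by simp
qed

lemma laplacian_quad_form_nonneg: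
  assumes y: "y \<in> carrier_vec N"
  shows "y \<bullet> (L *\<^sub>v y) \<ge> 0"
proof -
  have "y \<bullet> (L *\<^sub>v y) = (\<Sum>a<N. \<Sum>b<N. L $$ (a,b) * (y $ a * y $ b))"
    using laplacian_carrier y
    by (auto simp: scalar_prod_def sum_distrib_left atLeast0LessThan ac_simps intro!: sum.cong)
  then have "2 * (y \<bullet> (L *\<^sub>v y)) = (\<Sum>a<N. \<Sum>b<N. Adj $$ (a,b) * (y $ a - y $ b)\<^sup>2)"
    using laplacian_sum[of "\<lambda>a b. y $ a * y $ b"] by (simp add: power2_eq_square algebra_simps)
  also have "\<dots> \<ge> 0" by (intro sum_nonneg mult_nonneg_nonneg) (auto simp: adj_nonneg)
  finally show ?thesis by simp
qed

lemma laplacian_eigenvalue_nonneg: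
  assumes "eigenvalue L \<mu>"
  shows "\<mu> \<ge> 0"
proof -
  obtain v where v: "v \<in> carrier_vec N" "v \<noteq> 0\<^sub>v N" "L *\<^sub>v v = \<mu> \<cdot>\<^sub>v v"
    using assms laplacian_carrier unfolding eigenvalue_def eigenvector_def by auto
  then have "\<mu> * (v \<bullet> v) \<ge> 0" using laplacian_quad_form_nonneg[OF v(1)] by simp
  then show ?thesis
    using v scalar_prod_self_eq_0[OF v(1)] by (force simp: zero_le_mult_iff)
qed

lemma laplacian_eigenvalue_0:
  assumes "N > 0"
  shows "eigenvalue L 0"
proof -
  let ?v = "vec N (\<lambda>_. 1 :: real)"
  have "?v $ 0 \<noteq> (0\<^sub>v N :: real vec) $ 0" using assms by simp
  then have "?v \<noteq> 0\<^sub>v N" by metis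
  moreover have "L *\<^sub>v ?v = 0 \<cdot>\<^sub>v ?v"
    using laplacian_carrier
    by (intro eq_vecI) (auto simp: scalar_prod_def atLeast0LessThan laplacian_row_sum)
  ultimately show ?thesis
    using laplacian_carrier unfolding eigenvalue_def eigenvector_def by (auto intro!: exI[of _ ?v])
qed

text \<open>Nonzero eigenvalues of \<open>L\<close> are at least \<open>r\<close>, so L^2 >= r L as
  forms. Since c r >= 1 and L >= 0, it follows that c L^2 >= c r L >= L.\<close>

lemma laplacian_squared_ge:
  assumes "N > 0" and r: "r = eigenvalues_sorted L ! 1" "r > 0" and c: "c \<ge> 1 / r"
    and y: "y \<in> carrier_vec N"
  shows "y \<bullet> ((c \<cdot>\<^sub>m (L * L) - L) *\<^sub>v y) \<ge> 0"
proof -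
  note L = laplacian_carrier
  have "r * (y \<bullet> (L *\<^sub>v y)) \<le> y \<bullet> ((L * L) *\<^sub>v y)"
  proof (rule spectral_gap_quadratic[OF L laplacian_sym r(2) _ y])
    fix \<mu> assume "eigenvalue L \<mu>"
    then show "\<mu> \<le> 0 \<or> r \<le> \<mu>"
      using eigenvalues_sorted_gap[OF L laplacian_eigenvalue_0[OF \<open>N > 0\<close>] laplacian_eigenvalue_nonneg] r
      by force
  qed
  moreover have "c > 0" using c r(2) by (smt (verit) divide_pos_pos)
  ultimately have "c * (r * (y \<bullet> (L *\<^sub>v y))) \<le> c * (y \<bullet> ((L * L) *\<^sub>v y))" by simp
  moreover have "1 * (y \<bullet> (L *\<^sub>v y)) \<le> (c * r) * (y \<bullet> (L *\<^sub>v y))"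
    using c r(2) laplacian_quad_form_nonneg[OF y] by (intro mult_right_mono) (auto simp: field_simps)
  moreover have "y \<bullet> ((c \<cdot>\<^sub>m (L * L) - L) *\<^sub>v y) = c * (y \<bullet> ((L * L) *\<^sub>v y)) - y \<bullet> (L *\<^sub>v y)"
    using L y smult_mat_mult_vec[of "L * L" N N y c]
      minus_mult_distrib_mat_vec[of "c \<cdot>\<^sub>m (L * L)" N N L y]
    by (simp add: scalar_prod_minus_distrib[of _ N])
  ultimately show ?thesis by simp
qed

lemma laplacian_squared_row_sum:
  assumes "i < N"
  shows "(\<Sum>j<N. (L * L) $$ (i,j)) = 0"
proof -
  have "(\<Sum>j<N. (L * L) $$ (i,j)) = (\<Sum>j<N. \<Sum>k<N. L $$ (i,k) * L $$ (k,j))"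
    using laplacian_carrier assms by (auto simp: scalar_prod_def atLeast0LessThan intro!: sum.cong)
  also have "\<dots> = (\<Sum>k<N. L $$ (i,k) * (\<Sum>j<N. L $$ (k,j)))"
    by (subst sum.swap) (simp add: sum_distrib_left)
  finally show ?thesis by (simp add: laplacian_row_sum)
qed

text \<open>Twice the form is a sum of nonpositive edge terms. If it vanishes, so does each term;
  definiteness of \<open>Q\<close> then makes adjacent blocks equal, and connectivity makes all
  blocks equal.\<close>

lemma kron_laplacian_neg:
  assumes conn: "connected_adj N Adj" and N: "N > 0"
    and Q: "Q \<in> carrier_mat n n"
    and neg: "\<And>z. z \<in> carrier_vec n \<Longrightarrow> z \<noteq> 0\<^sub>v n \<Longrightarrow> z \<bullet> (Q *\<^sub>v z) < 0"
    and x: "x \<in> carrier_vec (N * n)"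
  shows "x \<bullet> (kron L Q *\<^sub>v x) \<le> 0"
    and "x \<bullet> (kron L Q *\<^sub>v x) = 0 \<Longrightarrow> x = ones_kron N (block n x 0)"
proof -
  let ?d = "\<lambda>a b. block n x a - block n x b"
  let ?q = "\<lambda>a b. Adj $$ (a,b) * (?d a b \<bullet> (Q *\<^sub>v ?d a b))"
  have d: "?d a b \<in> carrier_vec n" for a b by simp
  have q: "?q a b \<le> 0" if "a < N" "b < N" for a b
  proof -
    have "?d a b \<bullet> (Q *\<^sub>v ?d a b) \<le> 0"
      using neg[OF d, of a b] Q by (cases "?d a b = 0\<^sub>v n") auto
    then show ?thesis using adj_nonneg[OF that] by (simp add: mult_nonneg_nonpos)
  qed
  note form = kron_laplacian_quad_form[OF Q x]
  have "(\<Sum>a<N. \<Sum>b<N. ?q a b) \<le> 0" by (intro sum_nonpos q) auto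
  then show "x \<bullet> (kron L Q *\<^sub>v x) \<le> 0" using form by simp
  assume "x \<bullet> (kron L Q *\<^sub>v x) = 0"
  then have "(\<Sum>a<N. \<Sum>b<N. - ?q a b) = 0" using form by (simp add: sum_negf)
  then have "\<forall>a<N. (\<Sum>b<N. - ?q a b) = 0"
    using q by (subst (asm) sum_nonneg_eq_0_iff) (auto intro!: sum_nonneg)
  then have q0: "?q a b = 0" if "a < N" "b < N" for a b
    using that q sum_nonneg_eq_0_iff[of "{..<N}" "\<lambda>b. - ?q a b"] by auto
  have edge: "block n x a = block n x b" if "a < N" "b < N" "Adj $$ (a,b) = 1" for a b
  proof -
    have "?d a b = 0\<^sub>v n" using q0[OF that(1,2)] that(3) neg[OF d, of a b] by force
    then have "(block n x a - block n x b) $ k = 0" if "k < n" for k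
      using that by (metis index_zero_vec(1))
    then show ?thesis by (intro eq_vecI) (auto simp: block_def)
  qed
  show "x = ones_kron N (block n x 0)"
  proof (rule block_eq_imp_ones_kron[OF x])
    fix a assume "a < N"
    \<comment> \<open>Equality of blocks is carried along a path from \<open>a\<close> to node
      0.\<close>
    then have "(a, 0) \<in> {(a,b). a < N \<and> b < N \<and> Adj $$ (a,b) = 1}\<^sup>*"
      using conn N unfolding connected_adj_def by blast
    then show "block n x a = block n x 0"
      by (induction rule: converse_rtrancl_induct) (auto dest: edge)
  qed
qed

end

section \<open>The closed-loop matrix\<close>

text \<open>The Gram form exhibits symmetry and semidefiniteness; the other bracketing is the one
  that arises from the product of \<open>P\<close>, \<open>B\<close> and the feedback gain.\<close>

lemma gram_congruence_assoc:
  fixes P B :: "real mat"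
  assumes P: "P \<in> carrier_mat n n" and B: "B \<in> carrier_mat n m"
  shows "sym_mat P \<Longrightarrow> P * B * transpose_mat B * P = (P * B) * transpose_mat (P * B)"
    and "P * B * transpose_mat B * P = P * (B * (transpose_mat B * P))"
proof -
  have Bt: "transpose_mat B \<in> carrier_mat m n" and BtP: "transpose_mat B * P \<in> carrier_mat m n"
    using P B by auto
  have eq: "P * B * transpose_mat B * P = (P * B) * (transpose_mat B * P)"
    by (rule assoc_mult_mat[OF mult_carrier_mat[OF P B] Bt P])
  then show "P * B * transpose_mat B * P = P * (B * (transpose_mat B * P))"
    using assoc_mult_mat[OF P B BtP] by simp
  assume "sym_mat P"
  then have "transpose_mat (P * B) = transpose_mat B * P"
    using transpose_mult[OF P B] by (simp add: sym_mat_def)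
  then show "P * B * transpose_mat B * P = (P * B) * transpose_mat (P * B)"
    using eq by simp
qed

text \<open>As P B F = -M, the mixed-product rule gives \<open>kron L P * Ac\<close> the value G = L
  (x) PA - c L^2 (x) M. In G + G^T the term 2 L (x) M is added and subtracted, so that each of the
  two resulting summands can be given a sign.\<close>

lemma closed_loop_decomposition:
  fixes c :: real
  assumes L: "L \<in> carrier_mat N N" and symL: "sym_mat L"
    and P: "P \<in> carrier_mat n n" and symP: "sym_mat P"
    and A: "A \<in> carrier_mat n n" and B: "B \<in> carrier_mat n m"
  defines "M \<equiv> P * B * transpose_mat B * P"
    and "Ac \<equiv> kron (1\<^sub>m N) A + c \<cdot>\<^sub>m kron L (B * - (transpose_mat B * P))"
  shows "kron L P * Ac + transpose_mat Ac * kron L P =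
      kron L (P * A + transpose_mat A * P - 2 \<cdot>\<^sub>m M) - 2 \<cdot>\<^sub>m kron (c \<cdot>\<^sub>m (L * L) - L) M"
    and "sym_mat (kron L P * Ac + transpose_mat Ac * kron L P)"
proof -
  let ?G = "kron L (P * A) - c \<cdot>\<^sub>m kron (L * L) M"
  have BF: "B * - (transpose_mat B * P) \<in> carrier_mat n n" using B P by simp
  have M: "M \<in> carrier_mat n n"
    unfolding M_def using P B by (intro mult_carrier_mat[of _ n n] mult_carrier_mat[of _ n m] P) auto
  have PBF: "P * (B * - (transpose_mat B * P)) = - M"
  proof -
    have "B * - (transpose_mat B * P) = - (B * (transpose_mat B * P))"
      using B P by (intro uminus_mult_right_mat) auto
    moreover have "P * - (B * (transpose_mat B * P)) = - (P * (B * (transpose_mat B * P)))"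
      using B P by (intro uminus_mult_right_mat) auto
    moreover have "P * (B * (transpose_mat B * P)) = M"
      using gram_congruence_assoc(2)[OF P B] by (simp add: M_def)
    ultimately show ?thesis by simp
  qed
  have Ac: "Ac \<in> carrier_mat (N * n) (N * n)" and LP: "kron L P \<in> carrier_mat (N * n) (N * n)"
    using L P A BF by (auto simp: Ac_def)
  have "kron L P * Ac = kron L P * kron (1\<^sub>m N) A + c \<cdot>\<^sub>m (kron L P * kron L (B * - (transpose_mat B * P)))"
    unfolding Ac_def using LP A L BF
    by (simp add: mult_add_distrib_mat[of _ "N*n" "N*n" _ "N*n"] mult_smult_distrib[of _ "N*n" "N*n" _ "N*n"])
  also have "\<dots> = kron L (P * A) + c \<cdot>\<^sub>m kron (L * L) (- M)"
    unfolding kron_mult[OF L P one_carrier_mat A] kron_mult[OF L P L BF] PBF right_mult_one_mat[OF L] ..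
  also have "\<dots> = ?G"
    using L P A M by (intro eq_matI) (auto simp: kron_def div_mod_bounds)
  finally have G: "kron L P * Ac = ?G" .
  have LPt: "transpose_mat (kron L P) = kron L P"
    using symL symP by (simp add: transpose_kron sym_mat_def)
  have Gt: "transpose_mat Ac * kron L P = transpose_mat (kron L P * Ac)"
    using transpose_mult[OF LP Ac] LPt by simp
  have GC: "kron L P * Ac \<in> carrier_mat (N * n) (N * n)" using LP Ac by simp
  show "sym_mat (kron L P * Ac + transpose_mat Ac * kron L P)"
    unfolding sym_mat_def Gt
    using transpose_add[OF GC, of "transpose_mat (kron L P * Ac)"] GC
      comm_add_mat[OF GC, of "transpose_mat (kron L P * Ac)"] by simp
  have "P * B \<in> carrier_mat n m" using P B by simp
  then have Mt: "transpose_mat M = M"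
    unfolding M_def gram_congruence_assoc(1)[OF P B symP]
    by (simp add: transpose_mult[of "P * B" n m "transpose_mat (P * B)" n])
  have LLt: "transpose_mat (L * L) = L * L"
    using L symL by (simp add: sym_mat_def transpose_mult[of _ N N])
  have PAt: "transpose_mat (P * A) = transpose_mat A * P"
    using P A symP by (simp add: sym_mat_def transpose_mult[of _ n n])
  have car: "kron L (P * A) \<in> carrier_mat (N * n) (N * n)"
    "c \<cdot>\<^sub>m kron (L * L) M \<in> carrier_mat (N * n) (N * n)"
    using L P A M by auto
  have GT: "transpose_mat ?G = kron L (transpose_mat A * P) - c \<cdot>\<^sub>m kron (L * L) M"
    using symL unfolding transpose_minus[OF car]
    by (simp add: transpose_smult transpose_kron Mt LLt PAt sym_mat_def)
  \<comment> \<open>Opaque names for the products keep the entrywise comparison an identity between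
    plain matrix entries.\<close>
  define S T LL where "S = P * A" and "T = transpose_mat A * P" and "LL = L * L"
  have ST: "S \<in> carrier_mat n n" "T \<in> carrier_mat n n" "LL \<in> carrier_mat N N"
    using P A L by (auto simp: S_def T_def LL_def)
  show "kron L P * Ac + transpose_mat Ac * kron L P =
      kron L (P * A + transpose_mat A * P - 2 \<cdot>\<^sub>m M) - 2 \<cdot>\<^sub>m kron (c \<cdot>\<^sub>m (L * L) - L) M"
    unfolding Gt G GT
    unfolding S_def[symmetric] T_def[symmetric] LL_def[symmetric]
  proof (rule eq_matI)
    fix i j assume "i < dim_row (kron L (S + T - 2 \<cdot>\<^sub>m M) - 2 \<cdot>\<^sub>m kron (c \<cdot>\<^sub>m LL - L) M)"
      "j < dim_col (kron L (S + T - 2 \<cdot>\<^sub>m M) - 2 \<cdot>\<^sub>m kron (c \<cdot>\<^sub>m LL - L) M)"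
    then have i: "i < N * n" and j: "j < N * n" using L M ST by auto
    show "(kron L S - c \<cdot>\<^sub>m kron LL M + (kron L T - c \<cdot>\<^sub>m kron LL M)) $$ (i,j) =
        (kron L (S + T - 2 \<cdot>\<^sub>m M) - 2 \<cdot>\<^sub>m kron (c \<cdot>\<^sub>m LL - L) M) $$ (i,j)"
      using i j L M ST div_mod_bounds[OF i] div_mod_bounds[OF j]
      by (simp add: kron_def algebra_simps)
  qed (use L M ST in auto)
qed

text \<open>This presents the vectors 1 (x) s as the graph of a linear map, whose matrix stacks N -
  1 identity blocks; \<open>count_proots_char_poly_kernel_graph\<close> expects the kernel in this
  shape.\<close>

lemma ones_kron_eq_append:
  assumes s: "s \<in> carrier_vec n" and N: "N > 0"
  shows "ones_kron N s = s @\<^sub>v mat ((N - 1) * n) n (\<lambda>(i,j). if i mod n = j then 1 else 0) *\<^sub>v s"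
proof (rule eq_vecI)
  let ?R = "mat ((N - 1) * n) n (\<lambda>(i,j). if i mod n = j then 1 else 0) :: real mat"
  have dim: "n + (N - 1) * n = N * n" using N by (cases N) auto
  show "dim_vec (ones_kron N s) = dim_vec (s @\<^sub>v ?R *\<^sub>v s)"
    using s dim by (simp add: ones_kron_def)
  fix i assume "i < dim_vec (s @\<^sub>v ?R *\<^sub>v s)"
  then have i: "i < N * n" using s dim by simp
  then have mod: "i mod n < n" by (rule div_mod_bounds)
  have l: "ones_kron N s $ i = s $ (i mod n)" using s i by (simp add: ones_kron_def)
  show "ones_kron N s $ i = (s @\<^sub>v ?R *\<^sub>v s) $ i"
  proof (cases "i < n")
    case True
    then show ?thesis using l s by simp
  next
    case False
    \<comment> \<open>Dropping the first block shifts the index by \<open>n\<close>, which preserves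
      its residue.\<close>
    then have i': "i - n < (N - 1) * n" and m: "(i - n) mod n = i mod n"
      using i dim by (auto simp: le_mod_geq)
    have "(?R *\<^sub>v s) $ (i - n) = (\<Sum>j<n. (if i mod n = j then 1 else 0) * s $ j)"
      using i' m s by (simp add: scalar_prod_def atLeast0LessThan)
    also have "\<dots> = (\<Sum>j<n. if i mod n = j then s $ j else 0)"
      by (intro sum.cong) auto
    finally show ?thesis using l s i False dim mod by simp
  qed
qed

theorem theorem1:
  fixes n m N :: nat and A B P Adj :: "real mat" and \<alpha> c lam2 :: real
  assumes AB: "A \<in> carrier_mat n n" "B \<in> carrier_mat n m"
    and ctrl: "controllable n m A B"
    and alpha: "\<alpha> > 0"
    and P: "pos_def n P"
    and riccati: "neg_def n (P * A + transpose_mat A * P - 2 \<cdot>\<^sub>m (P * B * transpose_mat B * P) + (2 * \<alpha>) \<cdot>\<^sub>m P)"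
    and N2: "N \<ge> 2"
    and graph: "adj_graph N Adj" and conn: "connected_adj N Adj"
    and lam2: "lam2 = eigenvalues_sorted (laplacian N Adj) ! 1" and lam2_pos: "lam2 > 0"
    and c: "c \<ge> 1 / lam2"
  shows
    "let L = laplacian N Adj; F = - (transpose_mat B * P);
         Lhat = kron L P; Abar = kron (1\<^sub>m N) A; Bbar = c \<cdot>\<^sub>m kron L (B * F);
         Ac = Abar + Bbar; Lbar = Lhat * Ac + transpose_mat Ac * Lhat
     in sym_mat Lbar
        \<and> count (proots (char_poly Lbar)) 0 = n
        \<and> (\<forall>\<mu>. eigenvalue Lbar \<mu> \<longrightarrow> \<mu> = 0 \<or> \<mu> < 0)
        \<and> (\<forall>v. eigenvector Lbar v 0 \<longrightarrow> (\<exists>s \<in> carrier_vec n. v = ones_kron N s))"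
proof -
  define L where "L = laplacian N Adj"
  define M where "M = P * B * transpose_mat B * P"
  define Q where "Q = P * A + transpose_mat A * P - 2 \<cdot>\<^sub>m M"
  define X where "X = c \<cdot>\<^sub>m (L * L) - L"
  define Ac where "Ac = kron (1\<^sub>m N) A + c \<cdot>\<^sub>m kron L (B * - (transpose_mat B * P))"
  define Lbar where "Lbar = kron L P * Ac + transpose_mat Ac * kron L P"
  have N: "N > 0" using N2 by simp
  have Pc: "P \<in> carrier_mat n n" and symP: "sym_mat P" using P by (auto simp: pos_def_def)
  note Lc = laplacian_carrier[OF graph L_def]
  have PB: "P * B \<in> carrier_mat n m" using Pc AB by simp
  have M_gram: "M = (P * B) * transpose_mat (P * B)"
    unfolding M_def by (rule gram_congruence_assoc(1)[OF Pc AB(2) symP])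
  have Mc: "M \<in> carrier_mat n n" unfolding M_gram using PB by simp
  have Qc: "Q \<in> carrier_mat n n" unfolding Q_def by (intro minus_carrier_mat smult_carrier_mat Mc)
  have Xc: "X \<in> carrier_mat N N" unfolding X_def using Lc by (intro minus_carrier_mat)
  have dec: "Lbar = kron L Q - 2 \<cdot>\<^sub>m kron X M"
    unfolding Lbar_def Ac_def Q_def X_def M_def
    by (rule closed_loop_decomposition(1)[OF Lc laplacian_sym[OF graph L_def] Pc symP AB])
  have sym: "sym_mat Lbar"
    unfolding Lbar_def Ac_def
    by (rule closed_loop_decomposition(2)[OF Lc laplacian_sym[OF graph L_def] Pc symP AB])
  have LQ: "kron L Q \<in> carrier_mat (N * n) (N * n)" and XM: "kron X M \<in> carrier_mat (N * n) (N * n)"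
    using Lc Qc Xc Mc by auto
  then have Lbar_c: "Lbar \<in> carrier_mat (N * n) (N * n)"
    unfolding dec by (intro minus_carrier_mat smult_carrier_mat)
  have Lbar_v: "Lbar *\<^sub>v x = kron L Q *\<^sub>v x - 2 \<cdot>\<^sub>v (kron X M *\<^sub>v x)" if "x \<in> carrier_vec (N * n)" for x
    unfolding dec smult_mat_mult_vec[OF XM that, symmetric]
    using LQ XM that by (intro minus_mult_distrib_mat_vec) auto
  \<comment> \<open>The Riccati inequality says Q < -2 \<alpha> P, and \<open>P\<close> is positive
    definite.\<close>
  have Q_neg: "z \<bullet> (Q *\<^sub>v z) < 0" if z: "z \<in> carrier_vec n" "z \<noteq> 0\<^sub>v n" for z
  proof -
    have "z \<bullet> ((Q + (2 * \<alpha>) \<cdot>\<^sub>m P) *\<^sub>v z) < 0"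
      using riccati z unfolding neg_def_def Q_def M_def by blast
    moreover have "(Q + (2 * \<alpha>) \<cdot>\<^sub>m P) *\<^sub>v z = Q *\<^sub>v z + (2 * \<alpha>) \<cdot>\<^sub>v (P *\<^sub>v z)"
      unfolding smult_mat_mult_vec[OF Pc z(1), symmetric]
      using Qc Pc z by (intro add_mult_distrib_mat_vec) auto
    moreover have "z \<bullet> (P *\<^sub>v z) > 0" using P z by (simp add: pos_def_def)
    ultimately show ?thesis
      using alpha Qc Pc z by (simp add: scalar_prod_add_distrib[of _ n]) (smt (verit) mult_pos_pos)
  qed
  \<comment> \<open>\<open>X\<close> is positive semidefinite by the spectral gap and
    \<open>M\<close> is a Gram matrix, so the term -2 X (x) M can only lower the form.\<close>
  have form: "x \<bullet> (Lbar *\<^sub>v x) \<le> x \<bullet> (kron L Q *\<^sub>v x)" if x: "x \<in> carrier_vec (N * n)" for x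
  proof -
    have "x \<bullet> (kron X M *\<^sub>v x) \<ge> 0"
      unfolding M_gram
    proof (rule kron_gram_nonneg[OF Xc PB x])
      fix y :: "real vec" assume "y \<in> carrier_vec N"
      then show "y \<bullet> (X *\<^sub>v y) \<ge> 0"
        unfolding X_def
        using laplacian_squared_ge[OF graph L_def N _ lam2_pos c] lam2 by (simp add: L_def)
    qed
    then show ?thesis
      using x LQ XM by (simp add: Lbar_v scalar_prod_minus_distrib[of _ "N * n"])
  qed
  note LQ_neg = kron_laplacian_neg[OF graph L_def conn N Qc Q_neg]
  have ker: "\<exists>s\<in>carrier_vec n. x = ones_kron N s"
    if x: "x \<in> carrier_vec (N * n)" and "Lbar *\<^sub>v x = 0\<^sub>v (N * n)" for x
  proof -
    \<comment> \<open>On the kernel, 0 = x^T Lbar x <= x^T (L (x) Q) x <= 0.\<close>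
    have "x \<bullet> (kron L Q *\<^sub>v x) = 0" using form[OF x] LQ_neg(1)[OF _ _ x] that by simp
    then show ?thesis using LQ_neg(2)[OF _ _ x] block_carrier by blast
  qed
  have ones: "Lbar *\<^sub>v ones_kron N s = 0\<^sub>v (N * n)" if s: "s \<in> carrier_vec n" for s
  proof -
    \<comment> \<open>Both \<open>L\<close> and its square annihilate the all-ones vector, hence so
      does \<open>X\<close>.\<close>
    have "(\<Sum>b<N. X $$ (a,b)) = 0" if "a < N" for a
    proof -
      have "(\<Sum>b<N. X $$ (a,b)) = c * (\<Sum>b<N. (L * L) $$ (a,b)) - (\<Sum>b<N. L $$ (a,b))"
        using Lc that by (simp add: X_def sum_subtractf sum_distrib_left del: index_mult_mat(1))
      then show ?thesis
        using laplacian_row_sum[OF graph L_def that] laplacian_squared_row_sum[OF graph L_def that] by simp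
    qed
    then have "kron X M *\<^sub>v ones_kron N s = 0\<^sub>v (N * n)" by (rule kron_mult_ones_kron[OF Xc Mc s])
    moreover have "kron L Q *\<^sub>v ones_kron N s = 0\<^sub>v (N * n)"
      by (rule kron_mult_ones_kron[OF Lc Qc s laplacian_row_sum[OF graph L_def]])
    moreover have "ones_kron N s \<in> carrier_vec (N * n)"
      using s by (auto simp: ones_kron_def)
    ultimately show ?thesis by (auto simp: Lbar_v intro!: eq_vecI)
  qed
  have dim: "n + (N - 1) * n = N * n" using N by (cases N) auto
  let ?R = "mat ((N - 1) * n) n (\<lambda>(i,j). if i mod n = j then 1 else 0) :: real mat"
  have "count (proots (char_poly Lbar)) 0 = n"
  \<comment> \<open>The kernel is the graph of \<open>?R\<close>; rewriting with \<open>dim\<close>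
    identifies \<open>n + (N - 1) * n\<close> with \<open>N * n\<close>.\<close>
  proof (rule count_proots_char_poly_kernel_graph[of _ n "(N - 1) * n" ?R, unfolded dim])
    fix x :: "real vec" assume "x \<in> carrier_vec (N * n)"
    then show "Lbar *\<^sub>v x = 0\<^sub>v (N * n) \<longleftrightarrow> (\<exists>s\<in>carrier_vec n. x = s @\<^sub>v ?R *\<^sub>v s)"
      using ker ones ones_kron_eq_append[OF _ N] by metis
  qed (use Lbar_c sym in auto)
  moreover have "\<mu> \<le> 0" if ev: "eigenvalue Lbar \<mu>" for \<mu>
  proof -
    obtain v where v: "v \<in> carrier_vec (N * n)" "v \<noteq> 0\<^sub>v (N * n)" "Lbar *\<^sub>v v = \<mu> \<cdot>\<^sub>v v"
      using ev Lbar_c unfolding eigenvalue_def eigenvector_def by auto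
    \<comment> \<open>At an eigenvector the form of \<open>Lbar\<close> equals \<mu> |v|^2, so
      nonpositivity of the form bounds \<mu>.\<close>
    have "\<mu> * (v \<bullet> v) \<le> 0" using form[OF v(1)] LQ_neg(1)[OF _ _ v(1)] v by simp
    then show ?thesis
      using v scalar_prod_self_eq_0[OF v(1)] by (force simp: mult_le_0_iff)
  qed
  moreover have "\<exists>s\<in>carrier_vec n. v = ones_kron N s" if "eigenvector Lbar v 0" for v
  proof (rule ker)
    show v: "v \<in> carrier_vec (N * n)" using that Lbar_c by (auto simp: eigenvector_def)
    then show "Lbar *\<^sub>v v = 0\<^sub>v (N * n)"
      using that by (auto simp: eigenvector_def intro!: eq_vecI)
  qed
  ultimately show ?thesis
    using sym unfolding Let_def Lbar_def Ac_def L_def by (auto simp: less_le)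
qed

end
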